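(* Let $n\ge m$ be positive integers, $A\in\mathbb{R}^{n\times n}$, $B\in\mathbb{R}^{n\times m}$, $\Phi$ a real symmetric $n\times n$ matrix with $\Phi>0$, $\gamma>0$ real, and let $M$ be a real symmetric $n\times n$ matrix satisfying the standing assumptions on $M$ listed in the context. For any $k_1,k_2\in\mathbb{N}$, the functions $\mathrm{S}_{k_1},\mathrm{S}_{k_2}$ satisfy $$\mathrm{S}_{k_1+k_2}(x,y)=\sup_{\rho\in\mathbb{R}^n}\{\mathrm{S}_{k_1}(x,\rho)+\mathrm{S}_{k_2}(\rho,y)\}$$ for all $x,y\in\mathbb{R}^n$, and their Hessians $\Lambda_{k_1},\Lambda_{k_2}$ satisfy $$\Lambda_{k_1+k_2}=\Lambda_{k_1}\circledast\Lambda_{k_2}.$$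
   Context: $\mathbb{N}=\{1,2,\dots\}$. $\mathbb{M}^{n\times n}$ denotes the real symmetric $n\times n$ matrices; $P>0$ ($P\ge0$) means positive (semi)definite, and $P>Q$ means $P-Q>0$. Riccati operator: $\mathcal{R}(P)=\Phi+A^TPA+A^TPB(\gamma^2I-B^TPB)^{-1}B^TPA$ for $P\in\mathbb{M}^{n\times n}$; $\mathcal{R}_0$ is the identity and $\mathcal{R}_{k+1}=\mathcal{R}\circ\mathcal{R}_k$. Standing assumptions on $M\in\mathbb{M}^{n\times n}$: (i) $\gamma^2I-B^T\mathcal{R}_k(M)B>0$ for all integers $k\ge0$; (ii) $\mathcal{R}(M)-M>0$; (iii) $MB(\gamma^2I-B^TMB)^{-1}B^TM>0$. Dynamic programming evolution operators: $(\mathcal{S}\phi)(x)=\sup_{w\in\mathbb{R}^m}\{\frac12x^T\Phi x-\frac{\gamma^2}{2}|w|^2+\phi(Ax+Bw)\}$, $\mathcal{S}_0$ is the identity, and $\mathcal{S}_{k+1}\phi=\mathcal{S}(\mathcal{S}_k\phi)$. $\psi(x,z)=\frac12(x-z)^TM(x-z)$ for $x,z\in\mathbb{R}^n$, and $(\mathcal{D}_\psi\phi)(z)=-\sup_{x\in\mathbb{R}^n}\{\psi(x,z)-\phi(x)\}$. Auxiliary value function: $\widehat{\mathrm{S}}_k(x,z)=(\mathcal{S}_k\psi(\cdot,z))(x)$. Kernel: for $k\in\mathbb{N}$, $\mathrm{S}_k(x,y)=(\mathcal{D}_\psi\widehat{\mathrm{S}}_k(x,\cdot))(y)=-\sup_{z\in\mathbb{R}^n}\{\psi(z,y)-\widehat{\mathrm{S}}_k(x,z)\}$.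 Under the assumptions on $M$, $\mathrm{S}_k$ is a real-valued quadratic form $$\mathrm{S}_k(x,y)=\frac12\begin{bmatrix} x \\ y \end{bmatrix}^T\Lambda_k\begin{bmatrix} x \\ y \end{bmatrix},\qquad \Lambda_k=\begin{bmatrix}\Lambda_k^{11}&\Lambda_k^{12} \\ \Lambda_k^{21}&\Lambda_k^{22}\end{bmatrix}\in\mathbb{M}^{2n\times2n},$$ with $n\times n$ blocks; this defines the Hessian $\Lambda_k$. For $\Lambda,\Lambda'\in\mathbb{M}^{2n\times2n}$ written in $n\times n$ blocks $$\Lambda=\begin{bmatrix}\Lambda^{11}&\Lambda^{12} \\ \Lambda^{21}&\Lambda^{22}\end{bmatrix},\qquad \Lambda'=\begin{bmatrix}\Lambda'^{11}&\Lambda'^{12} \\ \Lambda'^{21}&\Lambda'^{22}\end{bmatrix},$$ and with $\Pi=\Lambda^{22}+\Lambda'^{11}$ (required to be invertible), $$\Lambda\circledast\Lambda'=\begin{bmatrix}\Lambda^{11}-\Lambda^{12}\Pi^{-1}\Lambda^{21}&-\Lambda^{12}\Pi^{-1}\Lambda'^{12} \\ -\Lambda'^{21}\Pi^{-1}\Lambda^{21}&\Lambda'^{22}-\Lambda'^{21}\Pi^{-1}\Lambda'^{12}\end{bmatrix}.$$ *)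

theory Defs
  imports "HOL-Analysis.Analysis"
begin

definition symmetric_matrix :: "real^'k^'k \<Rightarrow> bool" where
  "symmetric_matrix P \<longleftrightarrow> transpose P = P"

definition pos_def :: "real^'k^'k \<Rightarrow> bool" where
  "pos_def P \<longleftrightarrow> symmetric_matrix P \<and> (\<forall>x. x \<noteq> 0 \<longrightarrow> 0 < x \<bullet> (P *v x))"

text \<open>
  The type \<open>real^'m^'n\<close> is that of matrices with rows indexed by \<open>'n\<close> and columns by \<open>'m\<close>;
  \<open>mat c\<close> is \<open>c\<close> times the identity matrix. In the Riccati operator and in the standing
  assumptions \<open>matrix_inv\<close> is only applied to matrices that are assumed positive definite.
\<close>

definition riccati ::
  "real^'n^'n \<Rightarrow> real^'m^'n \<Rightarrow> real^'n^'n \<Rightarrow> real \<Rightarrow> real^'n^'n \<Rightarrow> real^'n^'n" where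
  "riccati A B \<Phi> \<gamma> P =
     \<Phi> + transpose A ** P ** A
       + transpose A ** P ** B ** matrix_inv (mat (\<gamma>\<^sup>2) - transpose B ** P ** B)
           ** transpose B ** P ** A"

definition standing_assumptions ::
  "real^'n^'n \<Rightarrow> real^'m^'n \<Rightarrow> real^'n^'n \<Rightarrow> real \<Rightarrow> real^'n^'n \<Rightarrow> bool" where
  "standing_assumptions A B \<Phi> \<gamma> M \<longleftrightarrow>
     (\<forall>k::nat. pos_def (mat (\<gamma>\<^sup>2) - transpose B ** (riccati A B \<Phi> \<gamma> ^^ k) M ** B)) \<and>
     pos_def (riccati A B \<Phi> \<gamma> M - M) \<and>
     pos_def (M ** B ** matrix_inv (mat (\<gamma>\<^sup>2) - transpose B ** M ** B) ** transpose B ** M)"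

text \<open>
  Suprema over the whole space may be infinite, so all functions are extended-real valued. The
  real quantities are injected by \<open>ereal\<close>, and in each operator one summand is finite, so that
  no expression of the form \<open>\<infinity> - \<infinity>\<close> arises.
\<close>

definition dp_op ::
  "real^'n^'n \<Rightarrow> real^'m^'n \<Rightarrow> real^'n^'n \<Rightarrow> real \<Rightarrow> (real^'n \<Rightarrow> ereal) \<Rightarrow> real^'n \<Rightarrow> ereal" where
  "dp_op A B \<Phi> \<gamma> \<phi> x =
     (SUP w::real^'m. ereal (1/2 * (x \<bullet> (\<Phi> *v x)) - \<gamma>\<^sup>2 / 2 * (norm w)\<^sup>2) + \<phi> (A *v x + B *v w))"

definition psi :: "real^'n^'n \<Rightarrow> real^'n \<Rightarrow> real^'n \<Rightarrow> real" where
  "psi M x z = 1/2 * ((x - z) \<bullet> (M *v (x - z)))"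

definition semiconvex_dual :: "real^'n^'n \<Rightarrow> (real^'n \<Rightarrow> ereal) \<Rightarrow> real^'n \<Rightarrow> ereal" where
  "semiconvex_dual M \<phi> z = - (SUP x. ereal (psi M x z) - \<phi> x)"

definition aux_value ::
  "real^'n^'n \<Rightarrow> real^'m^'n \<Rightarrow> real^'n^'n \<Rightarrow> real \<Rightarrow> real^'n^'n \<Rightarrow> nat
     \<Rightarrow> real^'n \<Rightarrow> real^'n \<Rightarrow> ereal" where
  "aux_value A B \<Phi> \<gamma> M k x z = (dp_op A B \<Phi> \<gamma> ^^ k) (\<lambda>\<xi>. ereal (psi M \<xi> z)) x"

definition kernel ::
  "real^'n^'n \<Rightarrow> real^'m^'n \<Rightarrow> real^'n^'n \<Rightarrow> real \<Rightarrow> real^'n^'n \<Rightarrow> nat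
     \<Rightarrow> real^'n \<Rightarrow> real^'n \<Rightarrow> ereal" where
  "kernel A B \<Phi> \<gamma> M k x y = semiconvex_dual M (\<lambda>z. aux_value A B \<Phi> \<gamma> M k x z) y"

text \<open>The \<open>2n\<close>-dimensional space is \<open>real^('n + 'n)\<close>; \<open>Inl\<close> indexes the first \<open>n\<close> coordinates.\<close>

definition join_vec :: "real^'n \<Rightarrow> real^'n \<Rightarrow> real^('n + 'n)" where
  "join_vec x y = (\<chi> i. case i of Inl a \<Rightarrow> x $ a | Inr b \<Rightarrow> y $ b)"

definition join_blocks ::
  "real^'n^'n \<Rightarrow> real^'n^'n \<Rightarrow> real^'n^'n \<Rightarrow> real^'n^'n \<Rightarrow> real^('n + 'n)^('n + 'n)" where
  "join_blocks P Q R S =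
     (\<chi> i j. case i of
        Inl a \<Rightarrow> (case j of Inl b \<Rightarrow> P $ a $ b | Inr b \<Rightarrow> Q $ a $ b)
      | Inr a \<Rightarrow> (case j of Inl b \<Rightarrow> R $ a $ b | Inr b \<Rightarrow> S $ a $ b))"

definition block11 :: "real^('n + 'n)^('n + 'n) \<Rightarrow> real^'n^'n" where
  "block11 L = (\<chi> a b. L $ Inl a $ Inl b)"

definition block12 :: "real^('n + 'n)^('n + 'n) \<Rightarrow> real^'n^'n" where
  "block12 L = (\<chi> a b. L $ Inl a $ Inr b)"

definition block21 :: "real^('n + 'n)^('n + 'n) \<Rightarrow> real^'n^'n" where
  "block21 L = (\<chi> a b. L $ Inr a $ Inl b)"

definition block22 :: "real^('n + 'n)^('n + 'n) \<Rightarrow> real^'n^'n" where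
  "block22 L = (\<chi> a b. L $ Inr a $ Inr b)"

definition is_hessian ::
  "(real^'n \<Rightarrow> real^'n \<Rightarrow> ereal) \<Rightarrow> real^('n + 'n)^('n + 'n) \<Rightarrow> bool" where
  "is_hessian F L \<longleftrightarrow>
     symmetric_matrix L \<and> (\<forall>x y. F x y = ereal (1/2 * (join_vec x y \<bullet> (L *v join_vec x y))))"

text \<open>
  A symmetric matrix is determined by its quadratic form, so there is at most one Hessian;
  if there is none, the value of the description below is unspecified.
\<close>

definition kernel_hessian ::
  "real^'n^'n \<Rightarrow> real^'m^'n \<Rightarrow> real^'n^'n \<Rightarrow> real \<Rightarrow> real^'n^'n \<Rightarrow> nat
     \<Rightarrow> real^('n + 'n)^('n + 'n)" where
  "kernel_hessian A B \<Phi> \<gamma> M k = (THE L. is_hessian (kernel A B \<Phi> \<gamma> M k) L)"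

definition circledast_pivot ::
  "real^('n + 'n)^('n + 'n) \<Rightarrow> real^('n + 'n)^('n + 'n) \<Rightarrow> real^'n^'n" where
  "circledast_pivot L L' = block22 L + block11 L'"

text \<open>The product below is meaningful only if \<open>circledast_pivot L L'\<close> is invertible.\<close>

definition circledast ::
  "real^('n::finite + 'n)^('n + 'n) \<Rightarrow> real^('n + 'n)^('n + 'n) \<Rightarrow> real^('n + 'n)^('n + 'n)" where
  "circledast L L' =
     (let J = matrix_inv (circledast_pivot L L') in
      join_blocks
        (block11 L - block12 L ** J ** block21 L)  (- (block12 L ** J ** block12 L'))
        (- (block21 L' ** J ** block21 L))         (block22 L' - block21 L' ** J ** block12 L'))"

end

theory Submission
  imports Defs
begin

text \<open>
  The kernel \<open>S\<^sub>k(x, y)\<close> is the largest payoff of a \<open>k\<close>-step trajectory from \<open>x\<close> that ends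
  at \<open>y\<close>. Seen this way, the semigroup law says that a trajectory of \<open>k1 + k2\<close> steps is cut at
  the point \<open>\<rho>\<close> which it reaches after \<open>k1\<close> steps. What has to be shown is that the kernel,
  which is defined through a semiconvex dual, really is this end-point payoff, and that every
  supremum is finite.

  Positive definiteness of \<open>M B (\<gamma>\<^sup>2 I - B\<^sup>T M B)\<^sup>-\<^sup>1 B\<^sup>T M\<close> forces \<open>M\<close> to be
  invertible and \<open>B\<close> to have rank \<open>n\<close>, hence to be square and
  invertible as \<open>m \<le> n\<close> (\<open>pos_def_gain_imp_inverses\<close>). A step from \<open>x\<close> to \<open>y\<close> thus determines
  its disturbance, and its payoff
  \<open>1/2 x\<^sup>T \<Phi> x - \<gamma>\<^sup>2/2 |B\<^sup>-\<^sup>1 (y - A x)|\<^sup>2\<close>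
  is a quadratic form in \<open>(x, y)\<close> (\<open>quad_step_hessian\<close>). If the pivot of two such forms
  is negative definite, completing the square shows that their max-plus convolution is attained
  and has the Hessian \<open>circledast\<close> (\<open>composable_circledast\<close>).

  The pivots are controlled by the value functions
  \<open>V\<^sub>j(x) = 1/2 x\<^sup>T \<R>\<^sub>j(M) x\<close>. The Riccati recursion says that the payoff of one step plus
  \<open>V\<^sub>j\<close> at its end is at most \<open>V\<^sub>j\<^sub>+\<^sub>1\<close> at its start, and
  definiteness of \<open>\<gamma>\<^sup>2 I - B\<^sup>T \<R>\<^sub>j(M) B\<close> that for the start
  \<open>0\<close> and an end \<open>y \<noteq> 0\<close> this sum is negative. Both properties are inherited by \<open>k\<close>-step
  payoffs (\<open>chain_invariant\<close>). Together they make all pivots negative definite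
  (\<open>composable_chain\<close>), so the \<open>k\<close>-step payoffs are max-plus powers of the one-step payoff, and
  the semigroup law reduces to associativity (\<open>chain_add\<close>).

  It remains to identify the kernel. By max-plus linearity the auxiliary value function is
  \<open>sup\<^sub>y (S\<^sub>k(x, y) + \<psi>(y, z))\<close> (\<open>dp_power_chain\<close>). This is a Legendre transform in
  disguise: \<open>y \<mapsto> S\<^sub>k(x, y) + 1/2 y\<^sup>T M y\<close> is strictly concave because \<open>V\<^sub>0\<close> is the form of \<open>M\<close>,
  and \<open>M\<close> is invertible, so \<open>semiconvex_dual\<close> inverts the transform
  (\<open>semiconvex_dual_quad\<close>).
\<close>

section \<open>Matrices and quadratic forms\<close>

lemma inner_transpose_mult:
  fixes C :: "real^'a^'b"
  shows "x \<bullet> (transpose C *v y) = (C *v x) \<bullet> y"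
  by (metis dot_lmul_matrix inner_commute transpose_matrix_vector)

lemma symmetric_matrix_inner:
  assumes "symmetric_matrix P"
  shows "(P *v x) \<bullet> y = x \<bullet> (P *v y)"
  using assms inner_transpose_mult[of x P y] by (simp add: symmetric_matrix_def)

lemma matrix_vector_mult_uminus_left: "(- C) *v x = - (C *v x)"
  for C :: "real^'a^'b"
  by (simp add: matrix_vector_mult_def vec_eq_iff sum_negf)

lemma symmetric_matrix_add:
  "symmetric_matrix P \<Longrightarrow> symmetric_matrix Q \<Longrightarrow> symmetric_matrix (P + Q)"
  by (simp add: symmetric_matrix_def transpose_def vec_eq_iff)

lemma symmetric_matrix_congruence:
  assumes "symmetric_matrix P"
  shows "symmetric_matrix (transpose C ** P ** C)"
  using assms
  by (simp add: symmetric_matrix_def matrix_transpose_mul matrix_mul_assoc)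

lemma symmetric_matrix_right_inverse:
  fixes P J :: "real^'n^'n"
  assumes "symmetric_matrix P" "P ** J = mat 1"
  shows "symmetric_matrix J"
proof -
  have "transpose J ** P = mat 1"
    using assms by (metis matrix_transpose_mul symmetric_matrix_def transpose_mat)
  then have "transpose J = transpose J ** (P ** J)"
    using assms by simp
  also have "\<dots> = J"
    by (simp add: matrix_mul_assoc \<open>transpose J ** P = mat 1\<close>)
  finally show ?thesis
    by (simp add: symmetric_matrix_def)
qed

lemma invertible_matrix_inv_right:
  fixes P :: "real^'n^'n"
  assumes "invertible P"
  shows "P ** matrix_inv P = mat 1"
  using assms unfolding invertible_def matrix_inv_def by (rule someI2_ex) simp

lemma pos_def_imp_invertible:
  assumes "pos_def P"
  shows "invertible P"
proof -
  have "x = 0" if "P *v x = 0" for x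
    using assms that unfolding pos_def_def by (metis inner_zero_right less_irrefl)
  then show ?thesis
    using matrix_left_invertible_ker[of P] invertible_left_inverse[of P] by blast
qed

lemma pos_def_uminus_imp_invertible:
  assumes "pos_def (- P)"
  shows "invertible P"
proof -
  have "x = 0" if "P *v x = 0" for x
    using assms that unfolding pos_def_def
    by (metis inner_zero_right less_irrefl matrix_vector_mult_uminus_left neg_equal_0_iff_equal)
  then show ?thesis
    using matrix_left_invertible_ker[of P] invertible_left_inverse[of P] by blast
qed

text \<open>
  Completing the square around the maximiser \<open>- J v\<close>. The inverse is an arbitrary \<open>J\<close> so that
  both a pivot with its inverse and \<open>- K\<close> with \<open>- matrix_inv K\<close> fit without rewriting
  \<open>matrix_inv (- K)\<close>.
\<close>

lemma concave_quadratic_max: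
  fixes P J :: "real^'n^'n"
  assumes neg: "pos_def (- P)" and inv: "P ** J = mat 1"
  shows "\<rho> \<bullet> v + 1/2 * (\<rho> \<bullet> (P *v \<rho>)) \<le> - 1/2 * (v \<bullet> (J *v v))"
    and "(- (J *v v)) \<bullet> v + 1/2 * ((- (J *v v)) \<bullet> (P *v (- (J *v v)))) = - 1/2 * (v \<bullet> (J *v v))"
proof -
  have sym: "symmetric_matrix P"
    using neg by (simp add: pos_def_def symmetric_matrix_def transpose_def vec_eq_iff)
  have PJ: "P *v (J *v u) = u" for u
    by (simp add: matrix_vector_mul_assoc inv)
  define s where "s = \<rho> + J *v v"
  have "s \<bullet> (P *v s) \<le> 0"
    using neg by (cases "s = 0") (auto simp: pos_def_def matrix_vector_mult_uminus_left less_imp_le)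
  moreover have "(J *v v) \<bullet> (P *v \<rho>) = v \<bullet> \<rho>"
    using symmetric_matrix_inner[OF sym, of "J *v v" \<rho>] PJ by simp
  ultimately show "\<rho> \<bullet> v + 1/2 * (\<rho> \<bullet> (P *v \<rho>)) \<le> - 1/2 * (v \<bullet> (J *v v))"
    unfolding s_def
    by (simp add: matrix_vector_right_distrib inner_add_left inner_add_right PJ inner_commute)
  show "(- (J *v v)) \<bullet> v + 1/2 * ((- (J *v v)) \<bullet> (P *v (- (J *v v)))) = - 1/2 * (v \<bullet> (J *v v))"
    using PJ[of "- v"]
    by (simp add: PJ linear_neg[OF matrix_vector_mul_linear] inner_commute)
qed

section \<open>Quadratic kernels and their max-plus product\<close>

definition quad :: "real^('n + 'n)^('n + 'n) \<Rightarrow> real^'n \<Rightarrow> real^'n \<Rightarrow> real" where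
  "quad L x y = 1/2 * (join_vec x y \<bullet> (L *v join_vec x y))"

lemma sum_UNIV_Plus:
  "sum f (UNIV :: ('a::finite + 'b::finite) set) = (\<Sum>a\<in>UNIV. f (Inl a)) + (\<Sum>b\<in>UNIV. f (Inr b))"
  by (simp add: UNIV_Plus_UNIV[symmetric] sum.Plus del: UNIV_Plus_UNIV)

lemma quad_blocks:
  "quad L x y = 1/2 * (x \<bullet> (block11 L *v x) + x \<bullet> (block12 L *v y)
                     + y \<bullet> (block21 L *v x) + y \<bullet> (block22 L *v y))"
  by (simp add: quad_def inner_vec_def matrix_vector_mult_def join_vec_def sum_UNIV_Plus
      block11_def block12_def block21_def block22_def distrib_left sum.distrib algebra_simps)

lemma block_join_blocks [simp]:
  "block11 (join_blocks P Q R S) = P" "block12 (join_blocks P Q R S) = Q"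
  "block21 (join_blocks P Q R S) = R" "block22 (join_blocks P Q R S) = S"
  by (simp_all add: block11_def block12_def block21_def block22_def join_blocks_def vec_eq_iff)

lemma symmetric_matrix_blocks:
  "symmetric_matrix L \<longleftrightarrow> symmetric_matrix (block11 L) \<and> block12 L = transpose (block21 L)
      \<and> symmetric_matrix (block22 L)"
proof
  assume "symmetric_matrix L"
  then have "\<And>i j. L $ j $ i = L $ i $ j"
    by (auto simp: symmetric_matrix_def transpose_def vec_eq_iff)
  then show "symmetric_matrix (block11 L) \<and> block12 L = transpose (block21 L)
      \<and> symmetric_matrix (block22 L)"
    by (simp add: symmetric_matrix_def transpose_def vec_eq_iff block11_def block12_def
        block21_def block22_def)
next
  assume r: "symmetric_matrix (block11 L) \<and> block12 L = transpose (block21 L)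
      \<and> symmetric_matrix (block22 L)"
  have "L $ j $ i = L $ i $ j" for i j
    using r by (cases i; cases j)
      (simp_all add: symmetric_matrix_def transpose_def vec_eq_iff block11_def block12_def
        block21_def block22_def)
  then show "symmetric_matrix L"
    by (simp add: symmetric_matrix_def transpose_def vec_eq_iff)
qed

lemma join_vec_surj: "\<exists>x y. u = join_vec x y"
proof -
  have "u = join_vec (\<chi> a. u $ Inl a) (\<chi> b. u $ Inr b)"
    by (simp add: join_vec_def vec_eq_iff split: sum.split)
  then show ?thesis by blast
qed

text \<open>By polarization, the reason why a kernel has at most one Hessian.\<close>

lemma quad_inject:
  assumes L: "symmetric_matrix L" and L': "symmetric_matrix L'"
    and eq: "\<And>x y. quad L x y = quad L' x y"
  shows "L = L'"
proof -
  have diag: "u \<bullet> (L *v u) = u \<bullet> (L' *v u)" for u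
    using eq join_vec_surj[of u] by (auto simp: quad_def)
  have polar: "2 * (u \<bullet> (K *v v)) = (u + v) \<bullet> (K *v (u + v)) - u \<bullet> (K *v u) - v \<bullet> (K *v v)"
    if "symmetric_matrix K" for K :: "real^('a + 'a)^('a + 'a)" and u v
    using symmetric_matrix_inner[OF that, of v u]
    by (simp add: matrix_vector_right_distrib inner_add_left inner_add_right inner_commute)
  have "u \<bullet> (L *v v) = u \<bullet> (L' *v v)" for u v
    using polar[OF L, of u v] polar[OF L', of u v] diag by simp
  then have "L *v v = L' *v v" for v
    by (metis vector_eq_ldot)
  then show ?thesis
    by (simp add: matrix_eq)
qed

lemma kernel_hessian_eqI:
  assumes "symmetric_matrix L" "\<And>x y. kernel A B \<Phi> \<gamma> M k x y = ereal (quad L x y)"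
  shows "is_hessian (kernel A B \<Phi> \<gamma> M k) L" "kernel_hessian A B \<Phi> \<gamma> M k = L"
proof -
  show L: "is_hessian (kernel A B \<Phi> \<gamma> M k) L"
    using assms by (simp add: is_hessian_def quad_def)
  have "L' = L" if "is_hessian (kernel A B \<Phi> \<gamma> M k) L'" for L'
    using that assms by (intro quad_inject) (auto simp: is_hessian_def quad_def)
  with L show "kernel_hessian A B \<Phi> \<gamma> M k = L"
    unfolding kernel_hessian_def by blast
qed

text \<open>
  The inequality is negative definiteness of \<open>circledast_pivot L L'\<close>, written with the two forms
  because it is proved below by comparing their values.
\<close>

definition composable ::
  "real^('n::finite + 'n)^('n + 'n) \<Rightarrow> real^('n + 'n)^('n + 'n) \<Rightarrow> bool" where
  "composable L L' \<longleftrightarrow>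
     symmetric_matrix L \<and> symmetric_matrix L' \<and> (\<forall>\<rho>. \<rho> \<noteq> 0 \<longrightarrow> quad L 0 \<rho> + quad L' \<rho> 0 < 0)"

lemma composable_pivot:
  assumes "composable L L'"
  shows "pos_def (- circledast_pivot L L')"
proof -
  have "symmetric_matrix (block22 L)" "symmetric_matrix (block11 L')"
    using assms by (simp_all add: composable_def symmetric_matrix_blocks)
  then have "symmetric_matrix (circledast_pivot L L')"
    unfolding circledast_pivot_def by (rule symmetric_matrix_add)
  then have "symmetric_matrix (- circledast_pivot L L')"
    by (simp add: symmetric_matrix_def transpose_def vec_eq_iff)
  moreover have "0 < \<rho> \<bullet> (- circledast_pivot L L' *v \<rho>)" if "\<rho> \<noteq> 0" for \<rho>
  proof -
    have "\<rho> \<bullet> (- circledast_pivot L L' *v \<rho>) = - 2 * (quad L 0 \<rho> + quad L' \<rho> 0)"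
      unfolding matrix_vector_mult_uminus_left
      by (simp add: circledast_pivot_def quad_blocks matrix_vector_mult_add_rdistrib inner_add_right
          inner_diff_right)
    with assms that show ?thesis
      by (auto simp: composable_def)
  qed
  ultimately show ?thesis
    by (simp add: pos_def_def)
qed

text \<open>
  As a function of the intermediate point \<open>\<rho>\<close>, the sum of the two forms is concave with Hessian
  the pivot and linear coefficient \<open>v = L\<^sup>2\<^sup>1 x + L'\<^sup>1\<^sup>2 y\<close>. Its maximum contributes
  \<open>- 1/2 v\<^sup>T J v\<close> with \<open>J\<close> the inverse of the pivot, which is the correction term of every
  block of \<open>circledast L L'\<close>.
\<close>

lemma composable_circledast:
  assumes "composable L L'"
  shows symmetric_circledast: "symmetric_matrix (circledast L L')"
    and quad_circledast_upper: "quad L x \<rho> + quad L' \<rho> y \<le> quad (circledast L L') x y"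
    and quad_circledast_attained: "\<exists>\<rho>. quad L x \<rho> + quad L' \<rho> y = quad (circledast L L') x y"
proof -
  define P where "P = circledast_pivot L L'"
  define J where "J = matrix_inv P"
  have neg: "pos_def (- P)"
    unfolding P_def using assms by (rule composable_pivot)
  have PJ: "P ** J = mat 1"
    unfolding J_def by (intro invertible_matrix_inv_right pos_def_uminus_imp_invertible neg)
  have symP: "symmetric_matrix P"
    using neg by (simp add: pos_def_def symmetric_matrix_def transpose_def vec_eq_iff)
  have symJ: "symmetric_matrix J"
    using symP PJ by (rule symmetric_matrix_right_inverse)
  have b: "symmetric_matrix (block11 L)" "block12 L = transpose (block21 L)"
     "symmetric_matrix (block22 L')" "block12 L' = transpose (block21 L')"
    using assms by (auto simp: composable_def symmetric_matrix_blocks)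
  have star: "circledast L L' = join_blocks
        (block11 L - block12 L ** J ** block21 L)  (- (block12 L ** J ** block12 L'))
        (- (block21 L' ** J ** block21 L))         (block22 L' - block21 L' ** J ** block12 L')"
    by (simp add: circledast_def Let_def J_def P_def)
  have b2: "block21 L' = transpose (block12 L')"
    by (simp add: b)
  have diff: "symmetric_matrix (Q - Q')" if "symmetric_matrix Q" "symmetric_matrix Q'"
    for Q Q' :: "real^'a^'a"
    using that by (simp add: symmetric_matrix_def transpose_def vec_eq_iff)
  have neg_tr: "transpose (- Q) = - transpose Q" for Q :: "real^'a^'a"
    by (simp add: transpose_def vec_eq_iff)
  have c1: "symmetric_matrix (block12 L ** J ** block21 L)"
    unfolding b(2) by (rule symmetric_matrix_congruence[OF symJ])
  have c2: "symmetric_matrix (block21 L' ** J ** block12 L')"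
    unfolding b2 by (rule symmetric_matrix_congruence[OF symJ])
  have c3: "block12 L ** J ** block12 L' = transpose (block21 L' ** J ** block21 L)"
    using symJ by (simp add: b matrix_transpose_mul matrix_mul_assoc symmetric_matrix_def)
  show "symmetric_matrix (circledast L L')"
    unfolding symmetric_matrix_blocks star block_join_blocks
    using diff[OF b(1) c1] diff[OF b(3) c2] c3 by (simp add: neg_tr)
  define v where "v = block21 L *v x + block12 L' *v y"
  have rho: "\<rho> \<bullet> v + 1/2 * (\<rho> \<bullet> (P *v \<rho>)) = quad L x \<rho> + quad L' \<rho> y
      - 1/2 * (x \<bullet> (block11 L *v x)) - 1/2 * (y \<bullet> (block22 L' *v y))" for \<rho>
    unfolding v_def quad_blocks P_def circledast_pivot_def b(2) b2
    by (simp add: inner_transpose_mult matrix_vector_mult_add_rdistrib inner_add_right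
        inner_commute algebra_simps del: transpose_matrix_vector)
  have mm: "a \<bullet> ((transpose C ** J ** D) *v c) = (C *v a) \<bullet> (J *v (D *v c))"
    for C D :: "real^'a^'a" and a c
    by (metis inner_transpose_mult matrix_vector_mul_assoc)
  have qs: "quad (circledast L L') x y
      = 1/2 * (x \<bullet> (block11 L *v x)) + 1/2 * (y \<bullet> (block22 L' *v y)) - 1/2 * (v \<bullet> (J *v v))"
    unfolding quad_blocks star block_join_blocks b(2) b2 v_def
    by (simp add: mm matrix_vector_mult_uminus_left matrix_vector_mult_diff_rdistrib
        matrix_vector_right_distrib inner_add_left inner_add_right inner_diff_right algebra_simps)
  show "quad L x \<rho> + quad L' \<rho> y \<le> quad (circledast L L') x y"
    using concave_quadratic_max(1)[OF neg PJ, of \<rho> v] rho[of \<rho>] qs by linarith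
  have "quad L x (- (J *v v)) + quad L' (- (J *v v)) y = quad (circledast L L') x y"
    using concave_quadratic_max(2)[OF neg PJ, of v] rho[of "- (J *v v)"] qs by linarith
  then show "\<exists>\<rho>. quad L x \<rho> + quad L' \<rho> y = quad (circledast L L') x y"
    by blast
qed

lemma quad_circledast_SUP:
  assumes "composable L L'"
  shows "ereal (quad (circledast L L') x y) = (SUP \<rho>. ereal (quad L x \<rho>) + ereal (quad L' \<rho> y))"
proof (rule antisym)
  obtain \<rho> where "quad L x \<rho> + quad L' \<rho> y = quad (circledast L L') x y"
    using quad_circledast_attained[OF assms] by blast
  then show "ereal (quad (circledast L L') x y)
      \<le> (SUP \<rho>. ereal (quad L x \<rho>) + ereal (quad L' \<rho> y))"
    by (intro SUP_upper2[of \<rho>]) auto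
qed (simp add: SUP_least quad_circledast_upper[OF assms])

text \<open>
  Both sides are the maximum of \<open>quad L1 x \<rho> + quad L2 \<rho> \<sigma> + quad L3 \<sigma> y\<close> over the pair
  \<open>(\<rho>, \<sigma>)\<close>, taken in different orders.
\<close>

lemma circledast_assoc:
  assumes "composable L1 L2" "composable L2 L3"
    and "composable (circledast L1 L2) L3" "composable L1 (circledast L2 L3)"
  shows "circledast (circledast L1 L2) L3 = circledast L1 (circledast L2 L3)"
proof (rule quad_inject)
  show "symmetric_matrix (circledast (circledast L1 L2) L3)"
    "symmetric_matrix (circledast L1 (circledast L2 L3))"
    using assms by (simp_all add: symmetric_circledast)
  fix x y
  show "quad (circledast (circledast L1 L2) L3) x y = quad (circledast L1 (circledast L2 L3)) x y"
  proof (rule antisym)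
    obtain \<sigma> where s: "quad (circledast L1 L2) x \<sigma> + quad L3 \<sigma> y
        = quad (circledast (circledast L1 L2) L3) x y"
      using quad_circledast_attained[OF assms(3)] by blast
    obtain \<rho> where r: "quad L1 x \<rho> + quad L2 \<rho> \<sigma> = quad (circledast L1 L2) x \<sigma>"
      using quad_circledast_attained[OF assms(1)] by blast
    show "quad (circledast (circledast L1 L2) L3) x y \<le> quad (circledast L1 (circledast L2 L3)) x y"
      using s r quad_circledast_upper[OF assms(2), of \<rho> \<sigma> y]
        quad_circledast_upper[OF assms(4), of x \<rho> y] by linarith
  next
    obtain \<rho> where r: "quad L1 x \<rho> + quad (circledast L2 L3) \<rho> y
        = quad (circledast L1 (circledast L2 L3)) x y"
      using quad_circledast_attained[OF assms(4)] by blast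
    obtain \<sigma> where s: "quad L2 \<rho> \<sigma> + quad L3 \<sigma> y = quad (circledast L2 L3) \<rho> y"
      using quad_circledast_attained[OF assms(2)] by blast
    show "quad (circledast L1 (circledast L2 L3)) x y \<le> quad (circledast (circledast L1 L2) L3) x y"
      using s r quad_circledast_upper[OF assms(1), of x \<rho> \<sigma>]
        quad_circledast_upper[OF assms(3), of x \<sigma> y] by linarith
  qed
qed

section \<open>Powers of a dissipative kernel\<close>

text \<open>
  \<open>L\<close> is the payoff of one step and \<open>V j\<close> an upper bound for what can still be gained with
  \<open>j\<close> steps to go; the two inequalities are the one-step form of what the powers of \<open>L\<close> inherit.
\<close>

locale dissipative =
  fixes L :: "real^('n::finite + 'n)^('n + 'n)" and V :: "nat \<Rightarrow> real^'n \<Rightarrow> real"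
  assumes sym: "symmetric_matrix L"
    and dissipation: "quad L x y + V j y \<le> V (Suc j) x"
    and strict: "y \<noteq> 0 \<Longrightarrow> quad L 0 y + V j y < 0"
    and V_zero: "V j 0 = 0"
begin

text \<open>Index \<open>k\<close> stands for \<open>k + 1\<close> factors, as \<open>circledast\<close> has no unit.\<close>

primrec chain :: "nat \<Rightarrow> real^('n + 'n)^('n + 'n)" where
  "chain 0 = L"
| "chain (Suc k) = circledast (chain k) L"

text \<open>
  The assumptions on \<open>L\<close> carry over to its powers. The bound telescopes along the
  optimal intermediate point \<open>\<rho>\<close>. For the strict inequality, a trajectory from \<open>0\<close> to \<open>y \<noteq> 0\<close>
  either is at some \<open>\<rho> \<noteq> 0\<close> before its last step, when the induction hypothesis at \<open>\<rho>\<close> is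
  strict, or makes that step from \<open>0\<close>, when the strict inequality for \<open>L\<close> applies.
\<close>

lemma chain_invariant:
  "symmetric_matrix (chain k) \<and> (\<forall>j x y. quad (chain k) x y + V j y \<le> V (Suc k + j) x) \<and>
   (\<forall>j y. y \<noteq> 0 \<longrightarrow> quad (chain k) 0 y + V j y < 0)"
proof (induction k)
  case 0
  show ?case
    using sym dissipation strict by simp
next
  case (Suc k)
  have comp: "composable (chain k) L"
    unfolding composable_def
  proof (intro conjI allI impI)
    fix \<rho> :: "real^'n" assume "\<rho> \<noteq> 0"
    then have "quad (chain k) 0 \<rho> + V (Suc 0) \<rho> < 0"
      using Suc by blast
    then show "quad (chain k) 0 \<rho> + quad L \<rho> 0 < 0"
      using dissipation[of \<rho> 0 0] V_zero[of 0] by linarith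
  qed (use Suc sym in auto)
  have bound: "quad (chain (Suc k)) x y + V j y \<le> V (Suc (Suc k) + j) x" for j x y
  proof -
    obtain \<rho> where r: "quad (chain k) x \<rho> + quad L \<rho> y = quad (chain (Suc k)) x y"
      using quad_circledast_attained[OF comp] by auto
    have "quad (chain k) x \<rho> + V (Suc j) \<rho> \<le> V (Suc k + Suc j) x"
      using Suc by blast
    then show ?thesis
      using r dissipation[of \<rho> y j] by simp
  qed
  have "quad (chain (Suc k)) 0 y + V j y < 0" if "y \<noteq> 0" for j y
  proof -
    obtain \<rho> where r: "quad (chain k) 0 \<rho> + quad L \<rho> y = quad (chain (Suc k)) 0 y"
      using quad_circledast_attained[OF comp] by auto
    show ?thesis
    proof (cases "\<rho> = 0")
      case True
      then show ?thesis
        using r strict[OF that, of j] by (simp add: quad_blocks)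
    next
      case False
      then have "quad (chain k) 0 \<rho> + V (Suc j) \<rho> < 0"
        using Suc by blast
      then show ?thesis
        using r dissipation[of \<rho> y j] by linarith
    qed
  qed
  with bound symmetric_circledast[OF comp] show ?case
    by simp
qed

text \<open>
  \<open>V (Suc l)\<close> separates the two forms: it dominates the \<open>\<rho>\<close>-part of the second one, and the first
  one plus \<open>V (Suc l)\<close> is still negative.
\<close>

lemma composable_chain: "composable (chain k) (chain l)"
  unfolding composable_def
proof (intro conjI allI impI)
  fix \<rho> :: "real^'n" assume "\<rho> \<noteq> 0"
  then have "quad (chain k) 0 \<rho> + V (Suc l + 0) \<rho> < 0"
    using chain_invariant by blast
  moreover have "quad (chain l) \<rho> 0 + V 0 0 \<le> V (Suc l + 0) \<rho>"
    using chain_invariant by blast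
  ultimately show "quad (chain k) 0 \<rho> + quad (chain l) \<rho> 0 < 0"
    using V_zero[of 0] by linarith
qed (use chain_invariant in auto)

lemma chain_add: "chain (Suc (k + l)) = circledast (chain k) (chain l)"
proof (induction l)
  case (Suc l)
  have "chain (Suc (k + Suc l)) = circledast (circledast (chain k) (chain l)) (chain 0)"
    using Suc by simp
  also have "\<dots> = circledast (chain k) (circledast (chain l) (chain 0))"
  proof (rule circledast_assoc)
    show "composable (circledast (chain k) (chain l)) (chain 0)"
      using composable_chain[of "Suc (k + l)" 0] Suc by simp
    show "composable (chain k) (circledast (chain l) (chain 0))"
      using composable_chain[of k "Suc l"] by simp
  qed (rule composable_chain)+
  finally show ?case
    by simp
qed simp

text \<open>
  Max-plus linearity: a supremum over the intermediate point may be exchanged with one over the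
  end point, for every extended-real \<open>\<phi>\<close>. The generality in \<open>\<phi>\<close> is needed for the
  induction, which applies the hypothesis to \<open>dp_op A B \<Phi> \<gamma> \<phi>\<close>.
\<close>

lemma dp_power_chain:
  assumes step: "\<And>\<phi> x. dp_op A B \<Phi> \<gamma> \<phi> x = (SUP y. ereal (quad L x y) + \<phi> y)"
  shows "(dp_op A B \<Phi> \<gamma> ^^ Suc k) \<phi> x = (SUP y. ereal (quad (chain k) x y) + \<phi> y)"
proof (induction k arbitrary: \<phi>)
  case 0
  show ?case
    by (simp add: step)
next
  case (Suc k)
  have pull: "(SUP \<rho>. ereal (quad (chain k) x \<rho> + quad L \<rho> y) + \<phi> y)
      = ereal (quad (chain (Suc k)) x y) + \<phi> y" for y
  proof (cases "\<phi> y = - \<infinity>")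
    case False
    have "(SUP \<rho>. ereal (quad (chain k) x \<rho> + quad L \<rho> y)) = ereal (quad (chain (Suc k)) x y)"
      using quad_circledast_SUP[OF composable_chain[of k 0], of x y] by simp
    then show ?thesis
      using False by (simp add: SUP_ereal_add_left)
  qed simp
  have "(dp_op A B \<Phi> \<gamma> ^^ Suc (Suc k)) \<phi> x = (dp_op A B \<Phi> \<gamma> ^^ Suc k) (dp_op A B \<Phi> \<gamma> \<phi>) x"
    by (simp only: funpow_Suc_right o_apply)
  also have "\<dots> = (SUP \<rho>. ereal (quad (chain k) x \<rho>) + (SUP y. ereal (quad L \<rho> y) + \<phi> y))"
    by (simp only: Suc step)
  also have "\<dots> = (SUP \<rho>. SUP y. ereal (quad (chain k) x \<rho> + quad L \<rho> y) + \<phi> y)"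
    by (simp add: SUP_ereal_add_right[symmetric] add.assoc[symmetric])
  also have "\<dots> = (SUP y. SUP \<rho>. ereal (quad (chain k) x \<rho> + quad L \<rho> y) + \<phi> y)"
    by (rule SUP_commute)
  also have "\<dots> = (SUP y. ereal (quad (chain (Suc k)) x y) + \<phi> y)"
    by (simp only: pull)
  finally show ?case .
qed

end

section \<open>Recovering a kernel from its semiconvex transform\<close>

text \<open>
  The inequality \<open>\<ge>\<close> is the general one for a twofold transform. For equality, \<open>y\<close> must be the
  maximiser in the inner supremum for some \<open>z\<close>. The function there is strictly concave, so
  it suffices to choose \<open>z\<close> such that its gradient
  \<open>L\<^sup>2\<^sup>1 x + L\<^sup>2\<^sup>2 y + M (y - z)\<close> vanishes; this is where \<open>M\<close> has to be invertible.
\<close>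

lemma semiconvex_dual_quad:
  fixes M :: "real^'n^'n"
  assumes sM: "symmetric_matrix M" and iM: "invertible M" and sL: "symmetric_matrix L"
    and neg: "\<And>y. y \<noteq> 0 \<Longrightarrow> quad L 0 y + 1/2 * (y \<bullet> (M *v y)) < 0"
  shows "semiconvex_dual M (\<lambda>z. SUP y. ereal (quad L x y) + ereal (psi M y z)) y
    = ereal (quad L x y)"
proof -
  define H where "H z = (SUP y. ereal (quad L x y) + ereal (psi M y z))" for z
  have psi_commute: "psi M a b = psi M b a" for a b
    using linear_neg[OF matrix_vector_mul_linear, of M "a - b"]
    by (simp add: psi_def) (metis inner_minus_left inner_minus_right minus_diff_eq minus_minus)
  have lower: "ereal (quad L x y + psi M z y) \<le> H z" for z
    unfolding H_def psi_commute[of z y] by (rule SUP_upper2[of y]) auto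
  define z0 where "z0 = y + matrix_inv M *v (block21 L *v x + block22 L *v y)"
  have Mz: "M *v (y - z0) = - (block21 L *v x + block22 L *v y)"
    by (simp add: z0_def matrix_vector_mul_assoc invertible_matrix_inv_right[OF iM]
        linear_neg[OF matrix_vector_mul_linear])
  \<comment> \<open>In the expansion around \<open>y\<close> the linear terms cancel by the choice of \<open>z0\<close>.\<close>
  have upper: "quad L x y' + psi M y' z0 \<le> quad L x y + psi M z0 y" for y'
  proof -
    define d where "d = y' - y"
    have y': "y' = y + d" by (simp add: d_def)
    have s: "symmetric_matrix (block22 L)" "block12 L = transpose (block21 L)"
      using sL by (auto simp: symmetric_matrix_blocks)
    have q: "quad L x y' = quad L x y + d \<bullet> (block21 L *v x + block22 L *v y) + quad L 0 d"
      using symmetric_matrix_inner[OF s(1), of y d]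
      by (simp add: quad_blocks y' s(2) inner_transpose_mult matrix_vector_right_distrib
          inner_add_left inner_add_right inner_commute algebra_simps
          del: transpose_matrix_vector)
    have "y' - z0 = (y - z0) + d" by (simp add: y')
    then have p: "psi M y' z0 = psi M y z0 + d \<bullet> (M *v (y - z0)) + 1/2 * (d \<bullet> (M *v d))"
      using symmetric_matrix_inner[OF sM, of "y - z0" d]
      by (simp only: psi_def matrix_vector_right_distrib inner_add_left inner_add_right)
        (simp add: inner_commute)
    have "quad L 0 d + 1/2 * (d \<bullet> (M *v d)) \<le> 0"
      using neg[of d] by (cases "d = 0") (auto simp: quad_blocks)
    then show ?thesis
      using q p Mz psi_commute[of z0 y] by (simp add: inner_add_right inner_diff_right)
  qed
  have "H z0 \<le> ereal (quad L x y + psi M z0 y)"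
    unfolding H_def by (rule SUP_least) (simp add: upper)
  then have Hz: "H z0 = ereal (quad L x y + psi M z0 y)"
    using lower[of z0] by (rule antisym)
  have "(SUP z. ereal (psi M z y) - H z) = ereal (- quad L x y)"
  proof (rule antisym)
    show "(SUP z. ereal (psi M z y) - H z) \<le> ereal (- quad L x y)"
    proof (rule SUP_least)
      fix z
      have "ereal (psi M z y) - H z \<le> ereal (psi M z y) - ereal (quad L x y + psi M z y)"
        using lower by (intro ereal_minus_mono) auto
      then show "ereal (psi M z y) - H z \<le> ereal (- quad L x y)"
        by simp
    qed
    show "ereal (- quad L x y) \<le> (SUP z. ereal (psi M z y) - H z)"
      by (rule SUP_upper2[of z0]) (simp_all add: Hz)
  qed
  then show ?thesis
    by (simp add: semiconvex_dual_def H_def)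
qed

section \<open>The one-step kernel\<close>

text \<open>
  \<open>R\<close> is injective, so its range has dimension \<open>n \<ge> m\<close> and is all of the \<open>m\<close>-dimensional space.
\<close>

lemma right_inverse_imp_left_inverse:
  fixes B :: "real^'m^'n" and R :: "real^'n^'m"
  assumes card: "CARD('m) \<le> CARD('n)" and BR: "B ** R = mat 1"
  shows "R ** B = mat 1"
proof -
  have BRv: "B *v (R *v x) = x" for x
    by (simp add: matrix_vector_mul_assoc BR)
  then have inj: "inj ((*v) R)"
    by (metis injI)
  have "dim (range ((*v) R)) = dim (UNIV :: (real^'n) set)"
    by (rule dim_image_eq) (use inj in \<open>auto intro: inj_on_subset\<close>)
  then have "dim (range ((*v) R)) = DIM(real^'m)"
    using card dim_subset_UNIV[of "range ((*v) R)"] by simp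
  then have "span (range ((*v) R)) = UNIV"
    by (simp only: dim_eq_full)
  then have surj: "range ((*v) R) = UNIV"
    by (metis matrix_vector_mul_linear linear_subspace_image span_eq_iff subspace_UNIV)
  have "R *v (B *v w) = w" for w
    using surj BRv by (metis rangeE UNIV_I)
  then show ?thesis
    by (simp add: matrix_eq matrix_vector_mul_assoc)
qed

text \<open>
  The product is invertible and begins with \<open>M\<close>, and once \<open>M\<close> is removed it begins with \<open>B\<close>.
\<close>

lemma pos_def_gain_imp_inverses:
  fixes M :: "real^'n^'n" and B :: "real^'m^'n"
  assumes card: "CARD('m) \<le> CARD('n)" and pd: "pos_def (M ** B ** W ** transpose B ** M)"
  shows "invertible M" "\<exists>R. B ** R = mat 1 \<and> R ** B = mat 1"
proof -
  obtain Y where "(M ** B ** W ** transpose B ** M) ** Y = mat 1"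
    using invertible_matrix_inv_right[OF pos_def_imp_invertible[OF pd]] by blast
  then have Y: "M ** (B ** (W ** transpose B ** M ** Y)) = mat 1"
    by (simp add: matrix_mul_assoc)
  then show "invertible M"
    using invertible_right_inverse by blast
  have "(B ** (W ** transpose B ** M ** Y)) ** M = mat 1"
    using Y by (simp add: matrix_left_right_inverse)
  then have "B ** (W ** transpose B ** M ** Y ** M) = mat 1"
    by (simp add: matrix_mul_assoc)
  then show "\<exists>R. B ** R = mat 1 \<and> R ** B = mat 1"
    using right_inverse_imp_left_inverse[OF card] by blast
qed

text \<open>The Hessian of the one-step payoff, with \<open>R\<close> in the role of the inverse of \<open>B\<close>.\<close>

definition step_hessian ::
  "real^'n^'n \<Rightarrow> real^'n^'m \<Rightarrow> real^'n^'n \<Rightarrow> real \<Rightarrow> real^('n + 'n)^('n + 'n)" where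
  "step_hessian A R \<Phi> \<gamma> = (let T = R ** A in join_blocks
     (\<Phi> - \<gamma>\<^sup>2 *\<^sub>R (transpose T ** T)) (\<gamma>\<^sup>2 *\<^sub>R (transpose T ** R))
     (\<gamma>\<^sup>2 *\<^sub>R (transpose R ** T)) (- (\<gamma>\<^sup>2 *\<^sub>R (transpose R ** R))))"

lemma quad_step_hessian:
  "quad (step_hessian A R \<Phi> \<gamma>) x y = 1/2 * (x \<bullet> (\<Phi> *v x)) - \<gamma>\<^sup>2/2 * (norm (R *v (y - A *v x)))\<^sup>2"
proof -
  have mm: "a \<bullet> ((transpose C ** D) *v c) = (C *v a) \<bullet> (D *v c)"
    for C D :: "real^'a^'b" and a c
    by (metis inner_transpose_mult matrix_vector_mul_assoc)
  have "R *v (y - A *v x) = R *v y - (R ** A) *v x"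
    by (simp add: matrix_vector_mult_diff_distrib matrix_vector_mul_assoc)
  then show ?thesis
    by (simp add: quad_blocks step_hessian_def Let_def mm power2_norm_eq_inner
        matrix_vector_mult_uminus_left matrix_vector_mult_diff_rdistrib
        scaleR_matrix_vector_assoc[symmetric] inner_diff_left inner_diff_right inner_commute
        algebra_simps)
qed

lemma symmetric_step_hessian:
  assumes "symmetric_matrix \<Phi>"
  shows "symmetric_matrix (step_hessian A R \<Phi> \<gamma>)"
proof -
  have "symmetric_matrix (transpose C ** C)" for C :: "real^'a^'b"
    by (simp add: symmetric_matrix_def matrix_transpose_mul)
  then have s: "transpose (\<gamma>\<^sup>2 *\<^sub>R (transpose C ** C)) = \<gamma>\<^sup>2 *\<^sub>R (transpose C ** C)"
    for C :: "real^'a^'b"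
    by (simp add: symmetric_matrix_def transpose_scalar)
  have d: "transpose (P - Q) = transpose P - transpose Q" "transpose (- P) = - transpose P"
    for P Q :: "real^'a^'a"
    by (simp_all add: transpose_def vec_eq_iff)
  show ?thesis
    using assms unfolding symmetric_matrix_blocks
    by (simp add: step_hessian_def Let_def symmetric_matrix_def d s)
       (simp add: transpose_scalar matrix_transpose_mul)
qed

text \<open>
  As \<open>B\<close> is invertible, choosing the disturbance amounts to choosing the next state.
\<close>

lemma dp_op_step:
  fixes A :: "real^'n^'n" and B :: "real^'m^'n" and R :: "real^'n^'m"
  assumes BR: "B ** R = mat 1" and RB: "R ** B = mat 1"
  shows "dp_op A B \<Phi> \<gamma> \<phi> x = (SUP y. ereal (quad (step_hessian A R \<Phi> \<gamma>) x y) + \<phi> y)"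
proof -
  have "y \<in> range (\<lambda>w. A *v x + B *v w)" for y
    by (rule range_eqI[of _ _ "R *v (y - A *v x)"]) (simp add: matrix_vector_mul_assoc BR)
  then have "range (\<lambda>w. A *v x + B *v w) = UNIV"
    by blast
  then have "(SUP y. ereal (quad (step_hessian A R \<Phi> \<gamma>) x y) + \<phi> y)
      = (SUP y\<in>range (\<lambda>w. A *v x + B *v w). ereal (quad (step_hessian A R \<Phi> \<gamma>) x y) + \<phi> y)"
    by simp
  also have "\<dots> = dp_op A B \<Phi> \<gamma> \<phi> x"
    by (simp add: image_image dp_op_def quad_step_hessian matrix_vector_mul_assoc RB)
  finally show ?thesis by simp
qed

lemma symmetric_riccati:
  assumes "symmetric_matrix \<Phi>" "symmetric_matrix P"
    and "pos_def (mat (\<gamma>\<^sup>2) - transpose B ** P ** B)"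
  shows "symmetric_matrix (riccati A B \<Phi> \<gamma> P)"
proof -
  define W where "W = matrix_inv (mat (\<gamma>\<^sup>2) - transpose B ** P ** B)"
  have sW: "symmetric_matrix W"
    unfolding W_def using assms(3)
    by (intro symmetric_matrix_right_inverse[OF _ invertible_matrix_inv_right]
        pos_def_imp_invertible) (auto simp: pos_def_def)
  have "symmetric_matrix (transpose (transpose B ** P ** A) ** W ** (transpose B ** P ** A))"
    by (rule symmetric_matrix_congruence[OF sW])
  then have "symmetric_matrix (transpose A ** P ** B ** W ** transpose B ** P ** A)"
    using assms(2) by (simp add: matrix_transpose_mul matrix_mul_assoc symmetric_matrix_def)
  then show ?thesis
    unfolding riccati_def W_def[symmetric]
    using assms by (intro symmetric_matrix_add symmetric_matrix_congruence)
qed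

lemma inner_mat_diff_congruence:
  "w \<bullet> ((mat c - transpose B ** P ** B) *v w) = c * (w \<bullet> w) - (B *v w) \<bullet> (P *v (B *v w))"
proof -
  have "mat c *v w = c *\<^sub>R w"
    by (simp add: vec_eq_iff matrix_vector_mult_def mat_def if_distrib[of "\<lambda>c. c * _"] cong: if_cong)
  moreover have "w \<bullet> ((transpose B ** P ** B) *v w) = (B *v w) \<bullet> (P *v (B *v w))"
    by (metis inner_transpose_mult matrix_vector_mul_assoc)
  ultimately show ?thesis
    by (simp add: matrix_vector_mult_diff_rdistrib inner_diff_right)
qed

text \<open>
  The Riccati operator is the result of maximising over the disturbance \<open>w\<close>: the quadratic term in
  \<open>w\<close> has Hessian \<open>- K\<close> and the linear one coefficient \<open>B\<^sup>T P A x\<close>.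
\<close>

lemma riccati_dissipation:
  assumes sP: "symmetric_matrix P"
    and K: "pos_def (mat (\<gamma>\<^sup>2) - transpose B ** P ** B)"
  shows "1/2 * (x \<bullet> (\<Phi> *v x)) - \<gamma>\<^sup>2/2 * (norm w)\<^sup>2
      + 1/2 * ((A *v x + B *v w) \<bullet> (P *v (A *v x + B *v w)))
    \<le> 1/2 * (x \<bullet> (riccati A B \<Phi> \<gamma> P *v x))"
proof -
  define K where "K = mat (\<gamma>\<^sup>2) - transpose B ** P ** B"
  define W where "W = matrix_inv K"
  have KW: "K ** W = mat 1"
    unfolding W_def K_def by (intro invertible_matrix_inv_right pos_def_imp_invertible assms)
  have KW': "(- K) ** (- W) = mat 1"
    using KW by (simp add: matrix_matrix_mult_def vec_eq_iff)
  define v where "v = transpose B *v (P *v (A *v x))"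
  have main: "w \<bullet> v + 1/2 * (w \<bullet> (- K *v w)) \<le> - 1/2 * (v \<bullet> (- W *v v))"
    using K by (intro concave_quadratic_max(1)[OF _ KW']) (simp add: K_def)
  have wv: "w \<bullet> v = (B *v w) \<bullet> (P *v (A *v x))"
    unfolding v_def by (rule inner_transpose_mult)
  have wK: "w \<bullet> (- K *v w) = - (\<gamma>\<^sup>2 * (w \<bullet> w)) + (B *v w) \<bullet> (P *v (B *v w))"
    unfolding matrix_vector_mult_uminus_left inner_minus_right K_def inner_mat_diff_congruence
    by simp
  have PB: "(P *v (A *v x)) \<bullet> (B *v w) = (A *v x) \<bullet> (P *v (B *v w))"
    by (rule symmetric_matrix_inner[OF sP])
  have "x \<bullet> ((transpose A ** P ** B ** W ** transpose B ** P ** A) *v x)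
      = x \<bullet> (transpose A *v (P *v (B *v (W *v v))))"
    by (simp add: v_def matrix_vector_mul_assoc matrix_mul_assoc)
  also have "\<dots> = v \<bullet> (W *v v)"
    unfolding v_def inner_transpose_mult
    by (metis inner_commute inner_transpose_mult symmetric_matrix_inner[OF sP])
  finally have xW: "x \<bullet> ((transpose A ** P ** B ** W ** transpose B ** P ** A) *v x) = v \<bullet> (W *v v)" .
  have xA: "x \<bullet> ((transpose A ** P ** A) *v x) = (A *v x) \<bullet> (P *v (A *v x))"
    by (metis inner_transpose_mult matrix_vector_mul_assoc)
  have "x \<bullet> (riccati A B \<Phi> \<gamma> P *v x)
      = x \<bullet> (\<Phi> *v x) + (A *v x) \<bullet> (P *v (A *v x)) + v \<bullet> (W *v v)"
    unfolding riccati_def K_def[symmetric] W_def[symmetric]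
    by (simp only: matrix_vector_mult_add_rdistrib inner_add_right xW xA)
  moreover have "(A *v x + B *v w) \<bullet> (P *v (A *v x + B *v w))
      = (A *v x) \<bullet> (P *v (A *v x)) + 2 * (w \<bullet> v) + (B *v w) \<bullet> (P *v (B *v w))"
    using wv PB
    by (simp add: matrix_vector_right_distrib inner_add_left inner_add_right inner_commute)
  moreover have "v \<bullet> (- W *v v) = - (v \<bullet> (W *v v))"
    by (simp add: matrix_vector_mult_uminus_left)
  ultimately show ?thesis
    using main wK unfolding power2_norm_eq_inner by linarith
qed

text \<open>
  Strictness comes from the definiteness of \<open>\<gamma>\<^sup>2 I - B\<^sup>T \<R>\<^sub>j(M) B\<close>, whose form at \<open>w\<close> is
  \<open>- 2\<close> times the payoff of the step from \<open>0\<close> to \<open>B w\<close> plus \<open>V\<^sub>j\<close> at its end.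
\<close>

lemma dissipative_step:
  fixes B :: "real^'m^'n" and R :: "real^'n^'m"
  assumes sym: "symmetric_matrix \<Phi>" "symmetric_matrix M"
    and K: "\<And>k. pos_def (mat (\<gamma>\<^sup>2) - transpose B ** (riccati A B \<Phi> \<gamma> ^^ k) M ** B)"
    and BR: "B ** R = mat 1"
  shows "dissipative (step_hessian A R \<Phi> \<gamma>)
    (\<lambda>j x. 1/2 * (x \<bullet> ((riccati A B \<Phi> \<gamma> ^^ j) M *v x)))"
proof
  show "symmetric_matrix (step_hessian A R \<Phi> \<gamma>)"
    using sym by (intro symmetric_step_hessian)
next
  fix x y :: "real^'n" and j
  have "symmetric_matrix ((riccati A B \<Phi> \<gamma> ^^ j) M)"
    by (induction j) (use sym K in \<open>auto intro: symmetric_riccati\<close>)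
  from riccati_dissipation[OF this K, of x \<Phi> "R *v (y - A *v x)" A]
  show "quad (step_hessian A R \<Phi> \<gamma>) x y + 1/2 * (y \<bullet> ((riccati A B \<Phi> \<gamma> ^^ j) M *v y))
      \<le> 1/2 * (x \<bullet> ((riccati A B \<Phi> \<gamma> ^^ Suc j) M *v x))"
    by (simp add: quad_step_hessian matrix_vector_mul_assoc BR)
next
  fix y :: "real^'n" and j
  assume "y \<noteq> 0"
  define w where "w = R *v y"
  have Bw: "B *v w = y"
    by (simp add: w_def matrix_vector_mul_assoc BR)
  with \<open>y \<noteq> 0\<close> have "w \<noteq> 0"
    by auto
  then have "0 < \<gamma>\<^sup>2 * (w \<bullet> w) - y \<bullet> ((riccati A B \<Phi> \<gamma> ^^ j) M *v y)"
    using K[of j] inner_mat_diff_congruence[of w "\<gamma>\<^sup>2" B] unfolding pos_def_def Bw by metis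
  then show "quad (step_hessian A R \<Phi> \<gamma>) 0 y + 1/2 * (y \<bullet> ((riccati A B \<Phi> \<gamma> ^^ j) M *v y)) < 0"
    by (simp add: quad_step_hessian w_def[symmetric] power2_norm_eq_inner)
qed simp

section \<open>The max-plus semigroup of kernels\<close>

theorem theorem5p3:
  fixes A :: "real^'n^'n" and B :: "real^'m^'n" and \<Phi> M :: "real^'n^'n"
    and \<gamma> :: real and k1 k2 :: nat
  assumes "CARD('m) \<le> CARD('n)"
    and "pos_def \<Phi>"
    and "\<gamma> > 0"
    and "symmetric_matrix M"
    and "standing_assumptions A B \<Phi> \<gamma> M"
    and "k1 \<ge> 1" and "k2 \<ge> 1"
  shows
    "(\<forall>x y. kernel A B \<Phi> \<gamma> M (k1 + k2) x y =
        (SUP \<rho>. kernel A B \<Phi> \<gamma> M k1 x \<rho> + kernel A B \<Phi> \<gamma> M k2 \<rho> y)) \<and>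
     (\<forall>k \<in> {k1, k2, k1 + k2}.
        is_hessian (kernel A B \<Phi> \<gamma> M k) (kernel_hessian A B \<Phi> \<gamma> M k)) \<and>
     invertible (circledast_pivot (kernel_hessian A B \<Phi> \<gamma> M k1) (kernel_hessian A B \<Phi> \<gamma> M k2)) \<and>
     kernel_hessian A B \<Phi> \<gamma> M (k1 + k2) =
       circledast (kernel_hessian A B \<Phi> \<gamma> M k1) (kernel_hessian A B \<Phi> \<gamma> M k2)"
proof -
  have K: "\<And>k. pos_def (mat (\<gamma>\<^sup>2) - transpose B ** (riccati A B \<Phi> \<gamma> ^^ k) M ** B)"
    and gain: "pos_def (M ** B ** matrix_inv (mat (\<gamma>\<^sup>2) - transpose B ** M ** B) ** transpose B ** M)"
    using assms(5) by (auto simp: standing_assumptions_def)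
  have iM: "invertible M"
    using pos_def_gain_imp_inverses(1)[OF assms(1) gain] .
  obtain R where BR: "B ** R = mat 1" and RB: "R ** B = mat 1"
    using pos_def_gain_imp_inverses(2)[OF assms(1) gain] by blast
  interpret dissipative "step_hessian A R \<Phi> \<gamma>"
    "\<lambda>j x. 1/2 * (x \<bullet> ((riccati A B \<Phi> \<gamma> ^^ j) M *v x))"
    using assms(2,4) K BR by (intro dissipative_step) (auto simp: pos_def_def)
  have ker: "kernel A B \<Phi> \<gamma> M (Suc k) x y = ereal (quad (chain k) x y)" for k x y
  proof -
    have neg: "quad (chain k) 0 y + 1/2 * (y \<bullet> (M *v y)) < 0" if "y \<noteq> 0" for y
      using chain_invariant[of k] that by (metis funpow_0)
    have "symmetric_matrix (chain k)"
      using chain_invariant by blast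
    from semiconvex_dual_quad[OF assms(4) iM this neg, of x y]
    show ?thesis
      unfolding kernel_def aux_value_def dp_power_chain[OF dp_op_step[OF BR RB]] .
  qed
  have hess: "is_hessian (kernel A B \<Phi> \<gamma> M (Suc k)) (chain k)"
    "kernel_hessian A B \<Phi> \<gamma> M (Suc k) = chain k" for k
    using kernel_hessian_eqI[OF _ ker] chain_invariant by blast+
  obtain a b where k: "k1 = Suc a" "k2 = Suc b"
    using assms(6,7) by (metis Suc_le_D One_nat_def)
  have sum: "k1 + k2 = Suc (Suc (a + b))"
    by (simp add: k)
  have "kernel A B \<Phi> \<gamma> M (k1 + k2) x y =
      (SUP \<rho>. kernel A B \<Phi> \<gamma> M k1 x \<rho> + kernel A B \<Phi> \<gamma> M k2 \<rho> y)" for x y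
    unfolding sum ker chain_add quad_circledast_SUP[OF composable_chain] unfolding k ker ..
  moreover have "\<forall>k \<in> {k1, k2, k1 + k2}.
      is_hessian (kernel A B \<Phi> \<gamma> M k) (kernel_hessian A B \<Phi> \<gamma> M k)"
    unfolding sum k using hess by (auto simp del: chain.simps)
  moreover have "invertible (circledast_pivot (kernel_hessian A B \<Phi> \<gamma> M k1)
      (kernel_hessian A B \<Phi> \<gamma> M k2))"
    unfolding k hess(2) by (intro pos_def_uminus_imp_invertible composable_pivot composable_chain)
  moreover have "kernel_hessian A B \<Phi> \<gamma> M (k1 + k2) =
      circledast (kernel_hessian A B \<Phi> \<gamma> M k1) (kernel_hessian A B \<Phi> \<gamma> M k2)"
    unfolding sum hess(2) chain_add unfolding k hess(2) ..
  ultimately show ?thesis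
    by blast
qed

end
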